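(* Let $\mathcal{I}$ and $\mathcal{J}$ be the focal and partner samples of the pair-interaction model described in the context. Assume that the treatments $\{D_k\}_{k\in\mathcal{I}\cup\mathcal{J}}$ are mutually independent with $\Pr(D_i=d)=p_d^{\mathcal{I}}$ for $i\in\mathcal{I}$ and $\Pr(D_j=d)=p_d^{\mathcal{J}}$ for $j\in\mathcal{J}$, $d\in\{0,1\}$, and that for each $(d,s)\in\{0,1\}^2$, $(D_i,D_{j(i)})$ is independent of $(Y_i(d,s),A_{j(i)})$. Assume also that the potential outcomes $\{Y_i(d,s)\}_{(d,s)\in\{0,1\}^2}$ together with $A_{j(i)}$ are independent and identically distributed across $i\in\mathcal{I}$, with $\Pr(A_{j(i)}=a)=p_a^A$, $a\in\{0,1\}$. Suppose $\beta_s^{2sls}$ is determined (through a unique minimizer) by $$(\beta_0^{2sls}, \beta_d^{2sls}, \beta_s^{2sls}) = \operatorname*{argmin}_{b_0, b_d, b_s\in\mathbb{R}} \mathbb{E}\big[(Y_i - b_0 - b_d D_i - b_s \mathbb{L}(S_i \mid D_i, D_{j(i)}))^2\big],$$ where $\mathbb{L}(S_i \mid D_i, D_{j(i)}) = \gamma_0 + \gamma_d D_i + \gamma_s D_{j(i)}$ with $(\gamma_0, \gamma_d, \gamma_s) = \operatorname*{argmin}_{a_0, a_d, a_s\in\mathbb{R}} \mathbb{E}[(S_i - a_0 - a_d D_i - a_s D_{j(i)})^2]$. Then $$\beta_s^{2sls} = \mathbb{E}[\bar\tau_i\mid A_{j(i)}= 1].$$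
   Context: Pair-interaction model. There are two disjoint samples: the focal sample $\mathcal{I}$ and the partner sample $\mathcal{J}$. Each $i\in\mathcal{I}$ has exactly one potential partner $j(i)\in\mathcal{J}$, and $j(i)\neq j(i')$ for $i\neq i'$. Each unit $k\in\mathcal{I}\cup\mathcal{J}$ has a random binary treatment $D_k\in\{0,1\}$. For each pair, $A_{j(i)}\in\{0,1\}$ is a random variable indicating whether $j(i)$'s treatment affects $i$'s outcome. The spillover variable is $S_i := A_{j(i)}D_{j(i)}\in\{0,1\}$. For $(d,s)\in\{0,1\}^2$, $Y_i(d,s)$ is a real random variable (potential outcome), and the observed outcome is $Y_i=\sum_{(d,s)\in\{0,1\}^2}\mathbf{1}\{D_i=d,S_i=s\}Y_i(d,s)$. Experimental design: the treatments $\{D_k\}_{k\in\mathcal{I}\cup\mathcal{J}}$ are mutually independent with $\Pr(D_i=d)=p_d^{\mathcal{I}}$ for $i\in\mathcal{I}$ and $\Pr(D_j=d)=p_d^{\mathcal{J}}$ for $j\in\mathcal{J}$, $d\in\{0,1\}$. In addition, for each $(d,s)\in\{0,1\}^2$, $(D_i,D_{j(i)})$ is independent of $(Y_i(d,s),A_{j(i)})$. IID sampling: the potential outcomes $\{Y_i(d,s)\}_{(d,s)\in\{0,1\}^2}$ together with $A_{j(i)}$ are independent and identically distributed across $i\in\mathcal{I}$, with $\Pr(A_{j(i)}=a)=p_a^A$, $a\in\{0,1\}$. ($A_{j(i)}$ may be dependent on $Y_i(d,s)$.) Because of the identical distributions across $i$, the expectations do not depend on $i\in\mathcal{I}$. Potential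 outcomes have finite second moments. Spillover effects: $\tau_i(d):=Y_i(d,1)-Y_i(d,0)$, $\bar\tau_i:=\tau_i(1)p_1^{\mathcal{I}}+\tau_i(0)p_0^{\mathcal{I}}$. *)

theory Defs
  imports "HOL-Probability.Probability"
begin

text \<open>
  Units of both samples live in one type \<open>'u\<close>; \<open>j i\<close> is the potential partner of \<open>i\<close>.
  Everything ranging over the set of 0 and 1 (treatments \<open>D\<close>, interaction indicators \<open>A\<close>, the
  arguments \<open>d\<close>, \<open>s\<close> of the potential outcomes) is a natural number, with the restriction to
  0 and 1 stated where it is used.
  The indicator written \<open>A\<close> with subscript \<open>j(i)\<close> on paper is \<open>A (j i)\<close>.
\<close>

definition spillover ::
  "('u \<Rightarrow> 'u) \<Rightarrow> ('u \<Rightarrow> 'w \<Rightarrow> nat) \<Rightarrow> ('u \<Rightarrow> 'w \<Rightarrow> nat) \<Rightarrow> 'u \<Rightarrow> 'w \<Rightarrow> nat" where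
  "spillover j A D i \<omega> = A (j i) \<omega> * D (j i) \<omega>"

definition observed_outcome ::
  "('u \<Rightarrow> 'u) \<Rightarrow> ('u \<Rightarrow> 'w \<Rightarrow> nat) \<Rightarrow> ('u \<Rightarrow> 'w \<Rightarrow> nat) \<Rightarrow>
   ('u \<Rightarrow> nat \<Rightarrow> nat \<Rightarrow> 'w \<Rightarrow> real) \<Rightarrow> 'u \<Rightarrow> 'w \<Rightarrow> real" where
  "observed_outcome j A D Y i \<omega> =
     (\<Sum>(d, s)\<in>{0, 1} \<times> {0, 1}. of_bool (D i \<omega> = d \<and> spillover j A D i \<omega> = s) * Y i d s \<omega>)"

definition spillover_effect ::
  "('u \<Rightarrow> nat \<Rightarrow> nat \<Rightarrow> 'w \<Rightarrow> real) \<Rightarrow> 'u \<Rightarrow> nat \<Rightarrow> 'w \<Rightarrow> real" where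
  "spillover_effect Y i d \<omega> = Y i d 1 \<omega> - Y i d 0 \<omega>"

definition avg_spillover_effect ::
  "(nat \<Rightarrow> real) \<Rightarrow> ('u \<Rightarrow> nat \<Rightarrow> nat \<Rightarrow> 'w \<Rightarrow> real) \<Rightarrow> 'u \<Rightarrow> 'w \<Rightarrow> real" where
  "avg_spillover_effect pI Y i \<omega> =
     spillover_effect Y i 1 \<omega> * pI 1 + spillover_effect Y i 0 \<omega> * pI 0"

text \<open>
  The complete vector of the four potential outcomes of \<open>i\<close> together with \<open>A (j i)\<close>, as one random
  variable with values in \<open>potential_space\<close>.
\<close>

definition potential_space :: "((nat \<times> nat \<Rightarrow> real) \<times> nat) measure" where
  "potential_space =
     (\<Pi>\<^sub>M ds\<in>{0, 1} \<times> {0, 1}. (borel :: real measure)) \<Otimes>\<^sub>M count_space UNIV"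

definition potential_vector ::
  "('u \<Rightarrow> 'u) \<Rightarrow> ('u \<Rightarrow> 'w \<Rightarrow> nat) \<Rightarrow> ('u \<Rightarrow> nat \<Rightarrow> nat \<Rightarrow> 'w \<Rightarrow> real) \<Rightarrow>
   'u \<Rightarrow> 'w \<Rightarrow> (nat \<times> nat \<Rightarrow> real) \<times> nat" where
  "potential_vector j A Y i \<omega> =
     ((\<lambda>(d, s)\<in>{0, 1} \<times> {0, 1}. Y i d s \<omega>), A (j i) \<omega>)"

text \<open>
  The library's \<open>indep_var\<close> needs both random variables to have the same value type. This is the
  same notion (cf. \<open>indep_var_eq\<close>) for different value types.
\<close>

definition indep_rvs ::
  "'w measure \<Rightarrow> 'a measure \<Rightarrow> ('w \<Rightarrow> 'a) \<Rightarrow> 'b measure \<Rightarrow> ('w \<Rightarrow> 'b) \<Rightarrow> bool" where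
  "indep_rvs M S X T Z \<longleftrightarrow>
     X \<in> measurable M S \<and> Z \<in> measurable M T \<and>
     prob_space.indep_set M
       (sigma_sets (space M) {X -` B \<inter> space M | B. B \<in> sets S})
       (sigma_sets (space M) {Z -` B \<inter> space M | B. B \<in> sets T})"

text \<open>
  Expectation conditional on an event: the expectation under \<open>M\<close> conditioned on \<open>E\<close>
  (only meaningful if \<open>E\<close> has positive probability).
\<close>

definition cond_expectation_event :: "'w measure \<Rightarrow> ('w \<Rightarrow> real) \<Rightarrow> 'w set \<Rightarrow> real" where
  "cond_expectation_event M X E = (\<integral>\<omega>. X \<omega> \<partial>uniform_measure M E)"

text \<open>
  The objective functions of the two least-squares problems. The first stage projects \<open>S\<close>
  on \<open>X\<close> and \<open>Z\<close>, the second one regresses \<open>Y\<close> on \<open>X\<close> and \<open>L\<close>; both are instances of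
  the mean squared error below, and \<open>linear_projection\<close> is the fitted variable.
\<close>

definition mean_sq_error ::
  "'w measure \<Rightarrow> ('w \<Rightarrow> real) \<Rightarrow> ('w \<Rightarrow> real) \<Rightarrow> ('w \<Rightarrow> real) \<Rightarrow> real \<times> real \<times> real \<Rightarrow> real" where
  "mean_sq_error M R X Z = (\<lambda>(c0, c1, c2). \<integral>\<omega>. (R \<omega> - c0 - c1 * X \<omega> - c2 * Z \<omega>)\<^sup>2 \<partial>M)"

definition linear_projection ::
  "real \<times> real \<times> real \<Rightarrow> ('w \<Rightarrow> real) \<Rightarrow> ('w \<Rightarrow> real) \<Rightarrow> 'w \<Rightarrow> real" where
  "linear_projection = (\<lambda>(c0, c1, c2) X Z \<omega>. c0 + c1 * X \<omega> + c2 * Z \<omega>)"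

end

(*
  A least-squares residual is orthogonal to every affine combination of the regressors.
  Write Z for the partner's treatment and q for its mean. In both stages test the residual
  against Z - q, which is uncorrelated with the focal treatment; in the second stage it is an
  affine combination of the regressors because the first-stage slope on Z is nonzero, as
  otherwise the second-stage minimizer would not be unique. Hence beta_s is the
  ratio E[Y (Z - q)] / E[S (Z - q)]. Exogeneity of the treatments factors out E[Z (Z - q)] from
  both, leaving E[tau A] / E[A].
*)
theory Submission
  imports Defs
begin

section \<open>Least squares with two regressors\<close>

text \<open>Membership in L2. Measurability of \<open>f\<close> is bundled in, because integrability
  of the square alone does not give it: \<open>f\<close> may change sign along a non-measurable
  set.\<close>

definition square_integrable :: "'w measure \<Rightarrow> ('w \<Rightarrow> real) \<Rightarrow> bool" where
  "square_integrable M f \<longleftrightarrow> f \<in> borel_measurable M \<and> integrable M (\<lambda>\<omega>. (f \<omega>)\<^sup>2)"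

lemma square_integrable_bound:
  assumes "integrable M g" and [measurable]: "f \<in> borel_measurable M"
    and "\<And>\<omega>. \<omega> \<in> space M \<Longrightarrow> (f \<omega>)\<^sup>2 \<le> g \<omega>"
  shows "square_integrable M f"
proof -
  have "AE \<omega> in M. norm ((f \<omega>)\<^sup>2) \<le> norm (g \<omega>)"
    using assms(3) by (intro AE_I2) fastforce
  then show ?thesis
    unfolding square_integrable_def using assms(1,2)
    by (auto intro!: Bochner_Integration.integrable_bound[OF assms(1)])
qed

text \<open>Domination of the product by the sum of the two squares.\<close>

lemma integrable_mult_square_integrable:
  assumes "square_integrable M f" "square_integrable M g"
  shows "integrable M (\<lambda>\<omega>. f \<omega> * g \<omega>)"
proof (rule Bochner_Integration.integrable_bound)
  show "integrable M (\<lambda>\<omega>. (f \<omega>)\<^sup>2 + (g \<omega>)\<^sup>2)"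
    using assms by (auto simp: square_integrable_def)
  show "(\<lambda>\<omega>. f \<omega> * g \<omega>) \<in> borel_measurable M"
    using assms by (auto simp: square_integrable_def)
  have "\<bar>x * y\<bar> \<le> x\<^sup>2 + y\<^sup>2" for x y :: real
    using sum_squares_bound[of "\<bar>x\<bar>" "\<bar>y\<bar>"] abs_ge_zero[of "x * y"]
    unfolding abs_mult power2_abs by linarith
  then show "AE \<omega> in M. norm (f \<omega> * g \<omega>) \<le> norm ((f \<omega>)\<^sup>2 + (g \<omega>)\<^sup>2)"
    by simp
qed

lemma square_integrable_cmult:
  "square_integrable M f \<Longrightarrow> square_integrable M (\<lambda>\<omega>. c * f \<omega>)"
  by (auto simp: square_integrable_def power_mult_distrib)

lemma square_integrable_add:
  assumes "square_integrable M f" "square_integrable M g"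
  shows "square_integrable M (\<lambda>\<omega>. f \<omega> + g \<omega>)"
  using assms integrable_mult_square_integrable[OF assms]
  by (auto simp: square_integrable_def power2_sum mult.assoc)

lemma square_integrable_diff:
  "square_integrable M f \<Longrightarrow> square_integrable M g \<Longrightarrow> square_integrable M (\<lambda>\<omega>. f \<omega> - g \<omega>)"
  using square_integrable_add[OF _ square_integrable_cmult[of M g "-1"], of f] by simp

context finite_measure
begin

lemma square_integrable_const: "square_integrable M (\<lambda>_. c)"
  by (simp add: square_integrable_def)

lemmas square_integrable_intros =
  square_integrable_const square_integrable_add square_integrable_diff square_integrable_cmult

lemma integrable_if_square_integrable: "square_integrable M f \<Longrightarrow> integrable M f"
  by (auto simp: square_integrable_def intro: square_integrable_imp_integrable)

end

text \<open>Expanding the square turns minimality into nonnegativity of a quadratic in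
  \<open>t\<close> that vanishes at \<open>t = 0\<close>. Its linear coefficient, a multiple of the
  integral in question, must then be zero.\<close>

lemma integral_mult_eq_0_if_minimal:
  assumes e: "square_integrable M e" and W: "square_integrable M W"
    and le: "\<And>t. (\<integral>\<omega>. (e \<omega>)\<^sup>2 \<partial>M) \<le> (\<integral>\<omega>. (e \<omega> - t * W \<omega>)\<^sup>2 \<partial>M)"
  shows "(\<integral>\<omega>. e \<omega> * W \<omega> \<partial>M) = 0"
proof -
  define a b where "a = (\<integral>\<omega>. (W \<omega>)\<^sup>2 \<partial>M)" and "b = (\<integral>\<omega>. e \<omega> * W \<omega> \<partial>M)"
  have ineq: "0 \<le> t * t * a - 2 * t * b" for t
  proof -
    have "(\<lambda>\<omega>. (e \<omega> - t * W \<omega>)\<^sup>2) = (\<lambda>\<omega>. (e \<omega>)\<^sup>2 - 2 * t * (e \<omega> * W \<omega>) + t * t * (W \<omega>)\<^sup>2)"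
      by (simp add: fun_eq_iff power2_eq_square algebra_simps)
    then have "(\<integral>\<omega>. (e \<omega> - t * W \<omega>)\<^sup>2 \<partial>M) = (\<integral>\<omega>. (e \<omega>)\<^sup>2 \<partial>M) - 2 * t * b + t * t * a"
      using e W integrable_mult_square_integrable[OF e W]
      by (simp add: a_def b_def square_integrable_def)
    with le[of t] show ?thesis by simp
  qed
  have "0 \<le> a" by (simp add: a_def)
  \<comment> \<open>The quadratic has its minimum at \<open>b / a\<close>. Enlarging the denominator
    by one keeps it nonzero even when \<open>a = 0\<close>, and the value of the quadratic is still
    negative unless \<open>b = 0\<close>.\<close>
  define t where "t = b / (a + 1)"
  have b: "b = t * (a + 1)" using \<open>0 \<le> a\<close> by (simp add: t_def)
  have "t * t * a - 2 * t * b = - (t\<^sup>2 * (a + 2))"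
    by (simp add: b power2_eq_square algebra_simps)
  with ineq[of t] have "t\<^sup>2 * (a + 2) \<le> 0" by simp
  with \<open>0 \<le> a\<close> have "t\<^sup>2 \<le> 0" by (simp add: mult_le_0_iff)
  then show ?thesis by (simp add: b flip: b_def)
qed

context finite_measure
begin

text \<open>The normal equations, obtained without differentiation: moving the coefficients by
  \<open>t\<close> in the direction \<open>(a0, a1, a2)\<close> subtracts \<open>t\<close> times the
  corresponding affine combination from the residual.\<close>

lemma mean_sq_error_orthogonal:
  assumes R: "square_integrable M R" and X: "square_integrable M X" and Z: "square_integrable M Z"
    and min: "is_arg_min (mean_sq_error M R X Z) (\<lambda>_. True) (c0, c1, c2)"
  shows "(\<integral>\<omega>. (R \<omega> - c0 - c1 * X \<omega> - c2 * Z \<omega>) * (a0 + a1 * X \<omega> + a2 * Z \<omega>) \<partial>M) = 0"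
proof (rule integral_mult_eq_0_if_minimal)
  show "square_integrable M (\<lambda>\<omega>. R \<omega> - c0 - c1 * X \<omega> - c2 * Z \<omega>)"
    by (intro square_integrable_intros R X Z)
  show "square_integrable M (\<lambda>\<omega>. a0 + a1 * X \<omega> + a2 * Z \<omega>)"
    by (intro square_integrable_intros X Z)
  fix t
  have "mean_sq_error M R X Z (c0, c1, c2) \<le>
      mean_sq_error M R X Z (c0 + t * a0, c1 + t * a1, c2 + t * a2)"
    using min by (simp add: is_arg_min_linorder)
  then show "(\<integral>\<omega>. (R \<omega> - c0 - c1 * X \<omega> - c2 * Z \<omega>)\<^sup>2 \<partial>M) \<le>
      (\<integral>\<omega>. (R \<omega> - c0 - c1 * X \<omega> - c2 * Z \<omega> - t * (a0 + a1 * X \<omega> + a2 * Z \<omega>))\<^sup>2 \<partial>M)"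
    by (simp add: mean_sq_error_def algebra_simps)
qed

end

text \<open>Shifting a minimizer by coefficients whose combination vanishes almost everywhere leaves
  the error unchanged, so the shifted point is a minimizer too. Uniqueness thus excludes collinear
  regressors; in the two-stage problem this yields the relevance of the instrument.\<close>

lemma unique_mean_sq_error_affinely_independent:
  assumes [measurable]: "R \<in> borel_measurable M" "X \<in> borel_measurable M" "Z \<in> borel_measurable M"
    and unique: "{b. is_arg_min (mean_sq_error M R X Z) (\<lambda>_. True) b} = {(c0, c1, c2)}"
    and affine: "AE \<omega> in M. a0 + a1 * X \<omega> + a2 * Z \<omega> = 0"
  shows "a0 = 0 \<and> a1 = 0 \<and> a2 = 0"
proof -
  have "AE \<omega> in M. (R \<omega> - (c0 + a0) - (c1 + a1) * X \<omega> - (c2 + a2) * Z \<omega>)\<^sup>2 =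
      (R \<omega> - c0 - c1 * X \<omega> - c2 * Z \<omega>)\<^sup>2"
    using affine
  proof eventually_elim
    case (elim \<omega>)
    then have "R \<omega> - (c0 + a0) - (c1 + a1) * X \<omega> - (c2 + a2) * Z \<omega> =
        R \<omega> - c0 - c1 * X \<omega> - c2 * Z \<omega>"
      by (simp add: algebra_simps)
    then show ?case by (rule arg_cong)
  qed
  then have "mean_sq_error M R X Z (c0 + a0, c1 + a1, c2 + a2) = mean_sq_error M R X Z (c0, c1, c2)"
    unfolding mean_sq_error_def prod.case by (intro integral_cong_AE) auto
  moreover have "is_arg_min (mean_sq_error M R X Z) (\<lambda>_. True) (c0, c1, c2)"
    using unique by auto
  ultimately have "(c0 + a0, c1 + a1, c2 + a2) \<in>
      {b. is_arg_min (mean_sq_error M R X Z) (\<lambda>_. True) b}"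
    by (simp add: is_arg_min_linorder)
  then show ?thesis unfolding unique by simp
qed

text \<open>The instrumental variable formula in a form without division. Since \<open>X\<close> is
  uncorrelated with \<open>Z - q\<close>, testing either residual against \<open>Z - q\<close>
  removes the constant and \<open>X\<close>. The first conclusion makes the ratio
  meaningful.\<close>

lemma (in prob_space) two_stage_least_squares:
  assumes R: "square_integrable M R" and S: "square_integrable M S"
    and X: "square_integrable M X" and Z: "square_integrable M Z"
    and q: "q = expectation Z"
    and uncorr: "expectation (\<lambda>\<omega>. X \<omega> * (Z \<omega> - q)) = 0"
    and first: "is_arg_min (mean_sq_error M S X Z) (\<lambda>_. True) (\<gamma>0, \<gamma>d, \<gamma>s)"
    and second: "{b. is_arg_min
         (mean_sq_error M R X (linear_projection (\<gamma>0, \<gamma>d, \<gamma>s) X Z)) (\<lambda>_. True) b} = {(\<beta>0, \<beta>d, \<beta>s)}"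
  shows "expectation (\<lambda>\<omega>. S \<omega> * (Z \<omega> - q)) \<noteq> 0"
    and "expectation (\<lambda>\<omega>. R \<omega> * (Z \<omega> - q)) = \<beta>s * expectation (\<lambda>\<omega>. S \<omega> * (Z \<omega> - q))"
proof -
  \<comment> \<open>This is the variance of \<open>Z\<close>, because \<open>Z - q\<close> has mean
    zero.\<close>
  define v where "v = expectation (\<lambda>\<omega>. Z \<omega> * (Z \<omega> - q))"
  let ?L = "linear_projection (\<gamma>0, \<gamma>d, \<gamma>s) X Z"
  have L_eq: "?L = (\<lambda>\<omega>. \<gamma>0 + \<gamma>d * X \<omega> + \<gamma>s * Z \<omega>)"
    by (simp add: linear_projection_def fun_eq_iff)
  have L: "square_integrable M ?L" unfolding L_eq by (intro square_integrable_intros X Z)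
  have W: "square_integrable M (\<lambda>\<omega>. Z \<omega> - q)" by (intro square_integrable_intros Z)
  have W0: "expectation (\<lambda>\<omega>. Z \<omega> - q) = 0"
    using integrable_if_square_integrable[OF Z] by (simp add: q prob_space)
  have [measurable]: "R \<in> borel_measurable M" "X \<in> borel_measurable M" "Z \<in> borel_measurable M"
      "?L \<in> borel_measurable M"
    using R X Z L by (auto simp: square_integrable_def)
  \<comment> \<open>Otherwise the fitted variable is affine in \<open>X\<close> alone, so the
    second-stage regressors are collinear.\<close>
  have \<gamma>s: "\<gamma>s \<noteq> 0"
  proof
    assume "\<gamma>s = 0"
    then have "AE \<omega> in M. \<gamma>0 + \<gamma>d * X \<omega> + (-1) * ?L \<omega> = 0" by (simp add: linear_projection_def)
    from unique_mean_sq_error_affinely_independent[OF _ _ _ second this] show False by simp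
  qed
  \<comment> \<open>If the variance vanished, \<open>Z\<close> would equal \<open>q\<close> almost
    everywhere and the fitted variable would again be affine in \<open>X\<close>, with
    \<open>\<gamma>s * q\<close> absorbed into the constant.\<close>
  have v: "v \<noteq> 0"
  proof
    assume "v = 0"
    have "integrable M (\<lambda>\<omega>. (Z \<omega> - q)\<^sup>2)" using W by (simp add: square_integrable_def)
    moreover have "expectation (\<lambda>\<omega>. (Z \<omega> - q)\<^sup>2) = 0"
    proof -
      have "(\<lambda>\<omega>. (Z \<omega> - q)\<^sup>2) = (\<lambda>\<omega>. Z \<omega> * (Z \<omega> - q) - q * (Z \<omega> - q))"
        by (simp add: fun_eq_iff power2_eq_square algebra_simps)
      then have "expectation (\<lambda>\<omega>. (Z \<omega> - q)\<^sup>2) = v - q * expectation (\<lambda>\<omega>. Z \<omega> - q)"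
        unfolding v_def
        using integrable_mult_square_integrable[OF Z W] integrable_if_square_integrable[OF W]
        by (simp only: Bochner_Integration.integral_diff integrable_mult_right integral_mult_right_zero)
      then show ?thesis using \<open>v = 0\<close> W0 by simp
    qed
    ultimately have "AE \<omega> in M. (Z \<omega> - q)\<^sup>2 = 0"
      by (subst (asm) integral_nonneg_eq_0_iff_AE) auto
    then have "AE \<omega> in M. (\<gamma>0 + \<gamma>s * q) + \<gamma>d * X \<omega> + (-1) * ?L \<omega> = 0"
      by eventually_elim (simp add: L_eq)
    from unique_mean_sq_error_affinely_independent[OF _ _ _ second this] show False by simp
  qed
  have lin: "expectation (\<lambda>\<omega>. f \<omega> - c0 * g \<omega> - c1 * h \<omega> - c2 * k \<omega>) =
      expectation f - c0 * expectation g - c1 * expectation h - c2 * expectation k"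
    if "integrable M f" "integrable M g" "integrable M h" "integrable M k"
    for f g h k :: "'a \<Rightarrow> real" and c0 c1 c2
    using that by simp
  \<comment> \<open>Stated for an arbitrary \<open>U\<close> with a residual affine in
    \<open>X\<close> and \<open>Z\<close>, so that it serves both stages: \<open>U\<close> is
    \<open>S\<close> in the first and \<open>R\<close> in the second. Only the coefficient of
    \<open>Z\<close> survives.\<close>
  have cov: "expectation (\<lambda>\<omega>. U \<omega> * (Z \<omega> - q)) = c2 * v"
    if U: "square_integrable M U"
      and orth: "expectation (\<lambda>\<omega>. (U \<omega> - c0 - c1 * X \<omega> - c2 * Z \<omega>) * (Z \<omega> - q)) = 0"
    for U c0 c1 c2
  proof -
    have "expectation (\<lambda>\<omega>. (U \<omega> - c0 - c1 * X \<omega> - c2 * Z \<omega>) * (Z \<omega> - q)) = expectation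
        (\<lambda>\<omega>. U \<omega> * (Z \<omega> - q) - c0 * (Z \<omega> - q) - c1 * (X \<omega> * (Z \<omega> - q)) - c2 * (Z \<omega> * (Z \<omega> - q)))"
      by (simp add: algebra_simps)
    also have "\<dots> = expectation (\<lambda>\<omega>. U \<omega> * (Z \<omega> - q)) - c0 * expectation (\<lambda>\<omega>. Z \<omega> - q)
        - c1 * expectation (\<lambda>\<omega>. X \<omega> * (Z \<omega> - q)) - c2 * v"
      unfolding v_def
      by (rule lin integrable_mult_square_integrable U X Z W integrable_if_square_integrable)+
    finally show ?thesis unfolding orth W0 uncorr by simp
  qed
  have "expectation (\<lambda>\<omega>. (S \<omega> - \<gamma>0 - \<gamma>d * X \<omega> - \<gamma>s * Z \<omega>) * (Z \<omega> - q)) = 0"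
    using mean_sq_error_orthogonal[OF S X Z first, of "-q" 0 1] by simp
  then have covS: "expectation (\<lambda>\<omega>. S \<omega> * (Z \<omega> - q)) = \<gamma>s * v"
    by (rule cov[OF S])
  then show "expectation (\<lambda>\<omega>. S \<omega> * (Z \<omega> - q)) \<noteq> 0" using \<gamma>s v by simp
  have min2: "is_arg_min (mean_sq_error M R X ?L) (\<lambda>_. True) (\<beta>0, \<beta>d, \<beta>s)"
    using second by auto
  \<comment> \<open>The first-stage fit solved for \<open>Z\<close>, which is possible because its
    slope on \<open>Z\<close> is nonzero. The test variable \<open>Z - q\<close> thereby lies in the
    span of the second-stage regressors.\<close>
  have affW: "(- \<gamma>0 / \<gamma>s - q) + (- \<gamma>d / \<gamma>s) * X \<omega> + (1 / \<gamma>s) * ?L \<omega> = Z \<omega> - q" for \<omega>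
    using \<gamma>s by (simp add: L_eq field_simps)
  \<comment> \<open>Substituting the fit expresses the second-stage residual through
    \<open>X\<close> and \<open>Z\<close>. The slope on \<open>Z\<close> becomes
    \<open>\<beta>s * \<gamma>s\<close>, so the covariance of \<open>R\<close> is \<beta>s times the
    covariance \<gamma>s v of \<open>S\<close>.\<close>
  have aff2: "R \<omega> - \<beta>0 - \<beta>d * X \<omega> - \<beta>s * ?L \<omega> =
      R \<omega> - (\<beta>0 + \<beta>s * \<gamma>0) - (\<beta>d + \<beta>s * \<gamma>d) * X \<omega> - (\<beta>s * \<gamma>s) * Z \<omega>" for \<omega>
    by (simp add: L_eq algebra_simps)
  have "expectation (\<lambda>\<omega>. (R \<omega> - (\<beta>0 + \<beta>s * \<gamma>0) - (\<beta>d + \<beta>s * \<gamma>d) * X \<omega> - (\<beta>s * \<gamma>s) * Z \<omega>)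
      * (Z \<omega> - q)) = 0"
    using mean_sq_error_orthogonal[OF R X L min2, of "- \<gamma>0 / \<gamma>s - q" "- \<gamma>d / \<gamma>s" "1 / \<gamma>s"]
    unfolding affW aff2 .
  from cov[OF R this] covS
  show "expectation (\<lambda>\<omega>. R \<omega> * (Z \<omega> - q)) = \<beta>s * expectation (\<lambda>\<omega>. S \<omega> * (Z \<omega> - q))"
    by simp
qed

section \<open>Independence and conditioning\<close>

text \<open>The sigma-algebra generated by a function of a variable is contained in the one
  generated by the variable. With \<open>g\<close> and \<open>h\<close> mapping into a common type,
  the result is ordinary \<open>indep_var\<close>, and its product rule for expectations becomes
  available.\<close>

lemma (in prob_space) indep_rvs_compose:
  assumes indep: "indep_rvs M S X T Z" and g: "g \<in> measurable S N" and h: "h \<in> measurable T N'"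
  shows "indep_var N (\<lambda>\<omega>. g (X \<omega>)) N' (\<lambda>\<omega>. h (Z \<omega>))"
proof -
  have sub: "sigma_sets (space M) {(\<lambda>\<omega>. k (U \<omega>)) -` B \<inter> space M | B. B \<in> sets L'} \<subseteq>
      sigma_sets (space M) {U -` B \<inter> space M | B. B \<in> sets L}"
    if U: "U \<in> measurable M L" and k: "k \<in> measurable L L'" for U k L L'
  proof (rule sigma_sets_mono', safe)
    fix B assume "B \<in> sets L'"
    then have "k -` B \<inter> space L \<in> sets L" using k by (rule measurable_sets[rotated])
    moreover have "(\<lambda>\<omega>. k (U \<omega>)) -` B \<inter> space M = U -` (k -` B \<inter> space L) \<inter> space M"
      using measurable_space[OF U] by auto
    ultimately show "\<exists>C. (\<lambda>\<omega>. k (U \<omega>)) -` B \<inter> space M = U -` C \<inter> space M \<and> C \<in> sets L"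
      by blast
  qed
  have X: "X \<in> measurable M S" and Z: "Z \<in> measurable M T"
    using indep by (auto simp: indep_rvs_def)
  have "indep_set
     (sigma_sets (space M) {(\<lambda>\<omega>. g (X \<omega>)) -` B \<inter> space M | B. B \<in> sets N})
     (sigma_sets (space M) {(\<lambda>\<omega>. h (Z \<omega>)) -` B \<inter> space M | B. B \<in> sets N'})"
    using indep sub[OF X g] sub[OF Z h] unfolding indep_rvs_def indep_set_def
    by (elim conjE indep_sets_mono_sets) (simp split: bool.split)
  moreover have "(\<lambda>\<omega>. g (X \<omega>)) \<in> measurable M N" "(\<lambda>\<omega>. h (Z \<omega>)) \<in> measurable M N'"
    using X Z g h by measurable
  ultimately show ?thesis by (simp add: indep_var_eq)
qed

text \<open>Restrictions of the family to the disjoint index sets \<open>{i}\<close> and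
  \<open>{k}\<close> are independent; evaluating them at the single index recovers the two
  variables.\<close>

lemma (in prob_space) indep_vars_imp_indep_var:
  assumes indep: "indep_vars (\<lambda>_. N) X K" and "i \<in> K" "k \<in> K" "i \<noteq> k"
  shows "indep_var N (X i) N (X k)"
proof -
  have "indep_var N ((\<lambda>f. f i) \<circ> (\<lambda>\<omega>. restrict (\<lambda>l. X l \<omega>) {i}))
      N ((\<lambda>f. f k) \<circ> (\<lambda>\<omega>. restrict (\<lambda>l. X l \<omega>) {k}))"
    using assms by (intro indep_var_compose[OF indep_var_restrict[OF indep]]) auto
  then show ?thesis by (simp add: comp_def)
qed

text \<open>The conditioned measure has the normalized indicator of \<open>E\<close> as its
  density.\<close>

lemma cond_expectation_event_eq:
  assumes [measurable]: "X \<in> borel_measurable M" "E \<in> sets M"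
    and E: "emeasure M E \<noteq> 0" "emeasure M E \<noteq> \<infinity>"
  shows "cond_expectation_event M X E = (\<integral>\<omega>. indicator E \<omega> * X \<omega> \<partial>M) / measure M E"
proof -
  have pos: "measure M E > 0"
    using E by (simp add: measure_def enn2real_positive_iff less_top zero_less_iff_neq_zero)
  have "emeasure M E = ennreal (measure M E)" using E by (simp add: emeasure_eq_ennreal_measure)
  then have "uniform_measure M E = density M (\<lambda>\<omega>. ennreal (indicator E \<omega> / measure M E))"
    unfolding uniform_measure_def using pos
    by (intro density_cong) (auto simp: divide_ennreal[symmetric] ennreal_indicator split: split_indicator)
  then have "cond_expectation_event M X E = (\<integral>\<omega>. (indicator E \<omega> / measure M E) * X \<omega> \<partial>M)"
    by (simp add: cond_expectation_event_def integral_density)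
  also have "\<dots> = (\<integral>\<omega>. indicator E \<omega> * X \<omega> \<partial>M) / measure M E"
    by simp
  finally show ?thesis .
qed

section \<open>Identification of the two-stage coefficient in the pair-interaction model\<close>

theorem proposition2p2:
  fixes M :: "'w measure"
    and I J :: "'u set"
    and j :: "'u \<Rightarrow> 'u"
    and D A :: "'u \<Rightarrow> 'w \<Rightarrow> nat"
    and Y :: "'u \<Rightarrow> nat \<Rightarrow> nat \<Rightarrow> 'w \<Rightarrow> real"
    and pI pJ pA :: "nat \<Rightarrow> real"
    and i :: 'u
    and \<beta>0 \<beta>d \<beta>s \<gamma>0 \<gamma>d \<gamma>s :: real
  assumes "prob_space M"
    and "I \<inter> J = {}" and "j ` I \<subseteq> J" and "inj_on j I"
    and D_binary: "\<And>k \<omega>. k \<in> I \<union> J \<Longrightarrow> \<omega> \<in> space M \<Longrightarrow> D k \<omega> \<in> {0, 1}"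
    and A_binary: "\<And>k \<omega>. k \<in> I \<Longrightarrow> \<omega> \<in> space M \<Longrightarrow> A (j k) \<omega> \<in> {0, 1}"
    and D_indep: "prob_space.indep_vars M (\<lambda>_. count_space UNIV) D (I \<union> J)"
    and D_focal: "\<And>k d. k \<in> I \<Longrightarrow> d \<in> {0, 1} \<Longrightarrow> \<P>(\<omega> in M. D k \<omega> = d) = pI d"
    and D_partner: "\<And>k d. k \<in> J \<Longrightarrow> d \<in> {0, 1} \<Longrightarrow> \<P>(\<omega> in M. D k \<omega> = d) = pJ d"
    and D_exogenous: "\<And>k d s. k \<in> I \<Longrightarrow> d \<in> {0, 1} \<Longrightarrow> s \<in> {0, 1} \<Longrightarrow>
      indep_rvs M
        (count_space UNIV \<Otimes>\<^sub>M count_space UNIV) (\<lambda>\<omega>. (D k \<omega>, D (j k) \<omega>))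
        (borel \<Otimes>\<^sub>M count_space UNIV) (\<lambda>\<omega>. (Y k d s \<omega>, A (j k) \<omega>))"
    and potential_indep:
      "prob_space.indep_vars M (\<lambda>_. potential_space) (potential_vector j A Y) I"
    and potential_ident: "\<And>k k'. k \<in> I \<Longrightarrow> k' \<in> I \<Longrightarrow>
      distr M potential_space (potential_vector j A Y k) =
      distr M potential_space (potential_vector j A Y k')"
    and A_prob: "\<And>k a. k \<in> I \<Longrightarrow> a \<in> {0, 1} \<Longrightarrow> \<P>(\<omega> in M. A (j k) \<omega> = a) = pA a"
    and second_moments: "\<And>k d s. k \<in> I \<Longrightarrow> d \<in> {0, 1} \<Longrightarrow> s \<in> {0, 1} \<Longrightarrow>
      integrable M (\<lambda>\<omega>. (Y k d s \<omega>)\<^sup>2)"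
    and "i \<in> I"
    and first_stage:
      "is_arg_min
         (mean_sq_error M (\<lambda>\<omega>. real (spillover j A D i \<omega>))
            (\<lambda>\<omega>. real (D i \<omega>)) (\<lambda>\<omega>. real (D (j i) \<omega>)))
         (\<lambda>_. True) (\<gamma>0, \<gamma>d, \<gamma>s)"
    and second_stage:
      "{b. is_arg_min
         (mean_sq_error M (observed_outcome j A D Y i) (\<lambda>\<omega>. real (D i \<omega>))
            (linear_projection (\<gamma>0, \<gamma>d, \<gamma>s)
               (\<lambda>\<omega>. real (D i \<omega>)) (\<lambda>\<omega>. real (D (j i) \<omega>))))
         (\<lambda>_. True) b} = {(\<beta>0, \<beta>d, \<beta>s)}"
  shows "\<beta>s = cond_expectation_event M (avg_spillover_effect pI Y i)
                {\<omega> \<in> space M. A (j i) \<omega> = 1}"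
proof -
  interpret prob_space M by fact
  let ?S = "\<lambda>\<omega>. real (spillover j A D i \<omega>)" and ?Y = "observed_outcome j A D Y i"
  define X where "X \<omega> = real (D i \<omega>)" for \<omega>
  define Z where "Z \<omega> = real (D (j i) \<omega>)" for \<omega>
  define B where "B \<omega> = real (A (j i) \<omega>)" for \<omega>
  define q where "q = expectation Z"
  define v where "v = expectation (\<lambda>\<omega>. Z \<omega> * (Z \<omega> - q))"

  \<comment> \<open>Measurability and square integrability\<close>
  have iI: "i \<in> I \<union> J" and jI: "j i \<in> I \<union> J" and ne: "i \<noteq> j i"
    using assms(2,3) \<open>i \<in> I\<close> by auto
  have [measurable]: "D i \<in> measurable M (count_space UNIV)"
      "D (j i) \<in> measurable M (count_space UNIV)"
    using D_indep iI jI by (auto simp: indep_vars_def)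
  \<comment> \<open>Measurability of the potential outcomes and of the interaction indicator is
    contained in exogeneity, as \<open>indep_rvs\<close> includes measurability of both
    variables.\<close>
  have YA: "Y i d s \<in> borel_measurable M" "A (j i) \<in> measurable M (count_space UNIV)"
    if "d \<in> {0, 1}" "s \<in> {0, 1}" for d s
  proof -
    have "(\<lambda>\<omega>. (Y i d s \<omega>, A (j i) \<omega>)) \<in> measurable M (borel \<Otimes>\<^sub>M count_space UNIV)"
      using D_exogenous[OF \<open>i \<in> I\<close> that] by (simp add: indep_rvs_def)
    from measurable_fst'[OF this] measurable_snd'[OF this]
    show "Y i d s \<in> borel_measurable M" "A (j i) \<in> measurable M (count_space UNIV)" by simp_all
  qed
  have [measurable]: "Y i 0 0 \<in> borel_measurable M" "Y i 0 1 \<in> borel_measurable M"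
      "Y i 1 0 \<in> borel_measurable M" "Y i 1 1 \<in> borel_measurable M"
      "A (j i) \<in> measurable M (count_space UNIV)"
    by (auto intro: YA)
  have [measurable]: "X \<in> borel_measurable M" "Z \<in> borel_measurable M" "B \<in> borel_measurable M"
    unfolding X_def Z_def B_def by measurable
  have X01: "X \<omega> = 0 \<or> X \<omega> = 1" and Z01: "Z \<omega> = 0 \<or> Z \<omega> = 1" and B01: "B \<omega> = 0 \<or> B \<omega> = 1"
    if "\<omega> \<in> space M" for \<omega>
    using D_binary[OF iI that] D_binary[OF jI that] A_binary[OF \<open>i \<in> I\<close> that]
    by (auto simp: X_def Z_def B_def)
  have S_eq: "?S \<omega> = B \<omega> * Z \<omega>" for \<omega> by (simp add: spillover_def B_def Z_def)
  have binary: "square_integrable M U"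
    if "U \<in> borel_measurable M" "\<And>\<omega>. \<omega> \<in> space M \<Longrightarrow> U \<omega> = 0 \<or> U \<omega> = (1::real)" for U
    using that(2) by (intro square_integrable_bound[OF integrable_const[of 1] that(1)]) force
  have X: "square_integrable M X" and Z: "square_integrable M Z" and B: "square_integrable M B"
    using X01 Z01 B01 by (simp_all add: binary)
  have S: "square_integrable M ?S"
    unfolding S_eq
  proof (rule binary)
    show "B \<omega> * Z \<omega> = 0 \<or> B \<omega> * Z \<omega> = 1" if "\<omega> \<in> space M" for \<omega>
      using B01[OF that] Z01[OF that] by auto
  qed measurable
  have Ysq: "square_integrable M (Y i d s)" if "d \<in> {0, 1}" "s \<in> {0, 1}" for d s
    using YA(1)[OF that] second_moments[OF \<open>i \<in> I\<close> that] by (simp add: square_integrable_def)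
  \<comment> \<open>Since the spillover is \<open>B * Z\<close>, the outcome is its value without
    spillover plus \<open>Z * B\<close> times the spillover effect at the realized treatment. Each
    \<open>B * Y\<close> is kept as one product, because the two factors may be dependent.\<close>
  have Y_eq: "?Y \<omega> = (1 - X \<omega>) * Y i 0 0 \<omega> + X \<omega> * Y i 1 0 \<omega>
      + Z \<omega> * (1 - X \<omega>) * (B \<omega> * Y i 0 1 \<omega> - B \<omega> * Y i 0 0 \<omega>)
      + Z \<omega> * X \<omega> * (B \<omega> * Y i 1 1 \<omega> - B \<omega> * Y i 1 0 \<omega>)" if "\<omega> \<in> space M" for \<omega>
    using D_binary[OF iI that] D_binary[OF jI that] A_binary[OF \<open>i \<in> I\<close> that]
    by (auto simp: observed_outcome_def spillover_def X_def Z_def B_def)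
  have Y: "square_integrable M ?Y"
  proof (rule square_integrable_bound)
    show "integrable M (\<lambda>\<omega>. (Y i 0 0 \<omega>)\<^sup>2 + (Y i 0 1 \<omega>)\<^sup>2 + (Y i 1 0 \<omega>)\<^sup>2 + (Y i 1 1 \<omega>)\<^sup>2)"
      using Ysq by (auto simp: square_integrable_def)
    have "(\<lambda>\<omega>. (1 - X \<omega>) * Y i 0 0 \<omega> + X \<omega> * Y i 1 0 \<omega>
      + Z \<omega> * (1 - X \<omega>) * (B \<omega> * Y i 0 1 \<omega> - B \<omega> * Y i 0 0 \<omega>)
      + Z \<omega> * X \<omega> * (B \<omega> * Y i 1 1 \<omega> - B \<omega> * Y i 1 0 \<omega>)) \<in> borel_measurable M"
      by measurable
    then show "?Y \<in> borel_measurable M" by (subst measurable_cong[OF Y_eq])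
    \<comment> \<open>At each point the observed outcome is one of the four potential
      outcomes.\<close>
    show "(?Y \<omega>)\<^sup>2 \<le> (Y i 0 0 \<omega>)\<^sup>2 + (Y i 0 1 \<omega>)\<^sup>2 + (Y i 1 0 \<omega>)\<^sup>2 + (Y i 1 1 \<omega>)\<^sup>2"
      if "\<omega> \<in> space M" for \<omega>
      unfolding Y_eq[OF that] using X01[OF that] Z01[OF that] B01[OF that] by auto
  qed

  \<comment> \<open>Factorization of expectations over treatments and potential outcomes\<close>
  have indepD: "indep_var (count_space UNIV) (D i) (count_space UNIV) (D (j i))"
    by (rule indep_vars_imp_indep_var[OF D_indep iI jI ne])
  have XZ: "expectation (\<lambda>\<omega>. f (X \<omega>) * g (Z \<omega>)) = expectation (\<lambda>\<omega>. f (X \<omega>)) * expectation (\<lambda>\<omega>. g (Z \<omega>))"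
    for f g :: "real \<Rightarrow> real"
  proof -
    have bdd: "integrable M (\<lambda>\<omega>. h (real (D k \<omega>)))" if "k \<in> {i, j i}" for h :: "real \<Rightarrow> real" and k
    proof (rule integrable_const_bound[of _ "max \<bar>h 0\<bar> \<bar>h 1\<bar>"])
      have [measurable]: "D k \<in> measurable M (count_space UNIV)" using that by auto
      show "AE \<omega> in M. norm (h (real (D k \<omega>))) \<le> max \<bar>h 0\<bar> \<bar>h 1\<bar>"
      proof (rule AE_I2)
        fix \<omega> assume "\<omega> \<in> space M"
        with that D_binary[of k \<omega>] iI jI have "D k \<omega> = 0 \<or> D k \<omega> = 1" by auto
        then show "norm (h (real (D k \<omega>))) \<le> max \<bar>h 0\<bar> \<bar>h 1\<bar>" by auto
      qed
      show "(\<lambda>\<omega>. h (real (D k \<omega>))) \<in> borel_measurable M" by measurable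
    qed
    have "indep_var borel ((\<lambda>n. f (real n)) \<circ> D i) borel ((\<lambda>n. g (real n)) \<circ> D (j i))"
      by (rule indep_var_compose[OF indepD]) auto
    then show ?thesis
      unfolding X_def Z_def using bdd
      by (intro indep_var_lebesgue_integral) (auto simp: comp_def)
  qed
  have W0: "expectation (\<lambda>\<omega>. Z \<omega> - q) = 0"
    using integrable_if_square_integrable[OF Z] by (simp add: q_def prob_space)
  have EX: "expectation (\<lambda>\<omega>. f (X \<omega>)) = f 1 * pI 1 + f 0 * pI 0" for f :: "real \<Rightarrow> real"
  proof -
    have "expectation (\<lambda>\<omega>. f (X \<omega>)) = expectation (\<lambda>\<omega>. f 1 * indicator {\<omega> \<in> space M. D i \<omega> = 1} \<omega>
        + f 0 * indicator {\<omega> \<in> space M. D i \<omega> = 0} \<omega>)"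
    proof (rule Bochner_Integration.integral_cong[OF refl])
      fix \<omega> assume "\<omega> \<in> space M"
      then show "f (X \<omega>) = f 1 * indicator {\<omega> \<in> space M. D i \<omega> = 1} \<omega>
          + f 0 * indicator {\<omega> \<in> space M. D i \<omega> = 0} \<omega>"
        using D_binary[OF iI, of \<omega>] by (auto simp: X_def)
    qed
    also have "\<dots> = f 1 * pI 1 + f 0 * pI 0"
    proof -
      have "integrable M (indicat_real {\<omega> \<in> space M. D i \<omega> = d})" for d
        by (simp add: emeasure_eq_measure)
      moreover have "expectation (indicat_real {\<omega> \<in> space M. D i \<omega> = d}) = pI d"
        if "d \<in> {0, 1}" for d
        using D_focal[OF \<open>i \<in> I\<close> that] by simp
      ultimately show ?thesis
        by (subst Bochner_Integration.integral_add) auto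
    qed
    finally show ?thesis .
  qed
  \<comment> \<open>Exogeneity separates the treatment pair from the outcome with its indicator, and
    \<open>XZ\<close> then separates the two treatments. Exogeneity is assumed for one
    \<open>(d, s)\<close> at a time, so only one potential outcome may occur in each
    product.\<close>
  have exo: "integrable M (\<lambda>\<omega>. f (X \<omega>) * g (Z \<omega>) * h (B \<omega>) (Y i d s \<omega>))"
    "expectation (\<lambda>\<omega>. f (X \<omega>) * g (Z \<omega>) * h (B \<omega>) (Y i d s \<omega>)) =
      expectation (\<lambda>\<omega>. f (X \<omega>)) * expectation (\<lambda>\<omega>. g (Z \<omega>)) * expectation (\<lambda>\<omega>. h (B \<omega>) (Y i d s \<omega>))"
    if ds: "d \<in> {0, 1}" "s \<in> {0, 1}"
      and h: "(\<lambda>(y, a). h (real a) y) \<in> borel_measurable (borel \<Otimes>\<^sub>M count_space UNIV)"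
      and hi: "integrable M (\<lambda>\<omega>. h (B \<omega>) (Y i d s \<omega>))"
    for d s and f g :: "real \<Rightarrow> real" and h :: "real \<Rightarrow> real \<Rightarrow> real"
  proof -
    have fg: "integrable M (\<lambda>\<omega>. f (X \<omega>) * g (Z \<omega>))"
    \<comment> \<open>Arbitrary \<open>f\<close> and \<open>g\<close> are harmless, as only their
      values at 0 and 1 matter; the bound is the largest of the four products.\<close>
    proof (rule integrable_const_bound[of _ "Max ((\<lambda>(x, z). \<bar>f x * g z\<bar>) ` ({0, 1} \<times> {0, 1}))"])
      show "AE \<omega> in M. norm (f (X \<omega>) * g (Z \<omega>)) \<le> Max ((\<lambda>(x, z). \<bar>f x * g z\<bar>) ` ({0, 1} \<times> {0, 1}))"
      proof (intro AE_I2 Max_ge)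
        fix \<omega> assume "\<omega> \<in> space M"
        then have "(X \<omega>, Z \<omega>) \<in> {0, 1} \<times> {0, 1}" using X01[of \<omega>] Z01[of \<omega>] by auto
        then show "norm (f (X \<omega>) * g (Z \<omega>)) \<in> (\<lambda>(x, z). \<bar>f x * g z\<bar>) ` ({0, 1} \<times> {0, 1})"
          by (rule rev_image_eqI) simp
      qed simp
      show "(\<lambda>\<omega>. f (X \<omega>) * g (Z \<omega>)) \<in> borel_measurable M"
        unfolding X_def Z_def by measurable
    qed
    have pair: "(\<lambda>(x, z). f (real x) * g (real z)) \<in>
        borel_measurable (count_space UNIV \<Otimes>\<^sub>M count_space UNIV)"
      by measurable
    have iv: "indep_var borel (\<lambda>\<omega>. f (X \<omega>) * g (Z \<omega>)) borel (\<lambda>\<omega>. h (B \<omega>) (Y i d s \<omega>))"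
      using indep_rvs_compose[OF D_exogenous[OF \<open>i \<in> I\<close> ds] pair h]
      by (simp add: X_def Z_def B_def)
    show "integrable M (\<lambda>\<omega>. f (X \<omega>) * g (Z \<omega>) * h (B \<omega>) (Y i d s \<omega>))"
      by (rule indep_var_integrable[OF iv fg hi])
    show "expectation (\<lambda>\<omega>. f (X \<omega>) * g (Z \<omega>) * h (B \<omega>) (Y i d s \<omega>)) =
      expectation (\<lambda>\<omega>. f (X \<omega>)) * expectation (\<lambda>\<omega>. g (Z \<omega>)) * expectation (\<lambda>\<omega>. h (B \<omega>) (Y i d s \<omega>))"
      unfolding indep_var_lebesgue_integral[OF iv fg hi] XZ ..
  qed

  \<comment> \<open>Covariances with the centred partner treatment\<close>
  have BY: "integrable M (\<lambda>\<omega>. B \<omega> * Y i d s \<omega>)" if "d \<in> {0, 1}" "s \<in> {0, 1}" for d s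
    by (rule integrable_mult_square_integrable[OF B Ysq[OF that]])
  \<comment> \<open>Here \<open>h\<close> ignores the outcome, so the choice of
    \<open>(0, 0)\<close> is arbitrary.\<close>
  have covS: "expectation (\<lambda>\<omega>. ?S \<omega> * (Z \<omega> - q)) = expectation B * v"
    using exo(2)[of 0 0 "\<lambda>b y. b" "\<lambda>_. 1" "\<lambda>z. z * (z - q)"] integrable_if_square_integrable[OF B]
    by (simp add: S_eq v_def prob_space mult_ac)
  define \<tau> where "\<tau> = avg_spillover_effect pI Y i"
  have covY: "expectation (\<lambda>\<omega>. ?Y \<omega> * (Z \<omega> - q)) = v * expectation (\<lambda>\<omega>. B \<omega> * \<tau> \<omega>)"
  proof -
    let ?f0 = "\<lambda>x::real. 1 - x" and ?f1 = "\<lambda>x::real. x" and ?g = "\<lambda>z. z - q" and ?h = "\<lambda>z. z * (z - q)"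
    \<comment> \<open>The expansion goes down to single potential outcomes, the form in which
      \<open>exo\<close> applies.\<close>
    have "expectation (\<lambda>\<omega>. ?Y \<omega> * (Z \<omega> - q)) = expectation (\<lambda>\<omega>.
        ?f0 (X \<omega>) * ?g (Z \<omega>) * Y i 0 0 \<omega> + ?f1 (X \<omega>) * ?g (Z \<omega>) * Y i 1 0 \<omega>
        + (?f0 (X \<omega>) * ?h (Z \<omega>) * (B \<omega> * Y i 0 1 \<omega>) - ?f0 (X \<omega>) * ?h (Z \<omega>) * (B \<omega> * Y i 0 0 \<omega>))
        + (?f1 (X \<omega>) * ?h (Z \<omega>) * (B \<omega> * Y i 1 1 \<omega>) - ?f1 (X \<omega>) * ?h (Z \<omega>) * (B \<omega> * Y i 1 0 \<omega>)))"
      by (intro Bochner_Integration.integral_cong) (simp_all add: Y_eq algebra_simps)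
    also have "\<dots> = pI 0 * v * (expectation (\<lambda>\<omega>. B \<omega> * Y i 0 1 \<omega>) - expectation (\<lambda>\<omega>. B \<omega> * Y i 0 0 \<omega>))
        + pI 1 * v * (expectation (\<lambda>\<omega>. B \<omega> * Y i 1 1 \<omega>) - expectation (\<lambda>\<omega>. B \<omega> * Y i 1 0 \<omega>))"
    proof -
      have Yi: "integrable M (Y i d s)" if "d \<in> {0, 1}" "s \<in> {0, 1}" for d s
        using integrable_if_square_integrable[OF Ysq[OF that]] .
      \<comment> \<open>The outcomes without spillover carry the factor \<open>Z - q\<close>, whose
        mean is zero, so they drop out.\<close>
      have 1: "integrable M (\<lambda>\<omega>. f (X \<omega>) * ?g (Z \<omega>) * Y i d s \<omega>)"
          "expectation (\<lambda>\<omega>. f (X \<omega>) * ?g (Z \<omega>) * Y i d s \<omega>) = 0"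
        if "d \<in> {0, 1}" "s \<in> {0, 1}" for d s and f :: "real \<Rightarrow> real"
        using exo[OF that, of "\<lambda>b y. y" f ?g] Yi[OF that] W0 by simp_all
      \<comment> \<open>The spillover terms carry \<open>Z * (Z - q)\<close> and contribute
        \<open>v\<close>. For \<open>f\<close> equal to \<open>1 - x\<close> or \<open>x\<close>,
        the first factor is \<open>pI 0\<close> or \<open>pI 1\<close>, which are the weights of the
        averaged effect.\<close>
      have 2: "integrable M (\<lambda>\<omega>. f (X \<omega>) * ?h (Z \<omega>) * (B \<omega> * Y i d s \<omega>))"
          "expectation (\<lambda>\<omega>. f (X \<omega>) * ?h (Z \<omega>) * (B \<omega> * Y i d s \<omega>)) =
            (f 1 * pI 1 + f 0 * pI 0) * v * expectation (\<lambda>\<omega>. B \<omega> * Y i d s \<omega>)"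
        if "d \<in> {0, 1}" "s \<in> {0, 1}" for d s and f :: "real \<Rightarrow> real"
        using exo[OF that, of "\<lambda>b y. b * y" f ?h] BY[OF that] by (simp_all add: EX v_def)
      show ?thesis
        using 1[of 0 0 ?f0] 1[of 1 0 ?f1] 2[of 0 1 ?f0] 2[of 0 0 ?f0] 2[of 1 1 ?f1] 2[of 1 0 ?f1]
        by (simp only: insert_iff simp_thms Bochner_Integration.integral_add Bochner_Integration.integral_diff
            Bochner_Integration.integrable_add Bochner_Integration.integrable_diff)
          (simp add: algebra_simps)
    qed
    also have "\<dots> = v * expectation (\<lambda>\<omega>. pI 0 * (B \<omega> * Y i 0 1 \<omega>) - pI 0 * (B \<omega> * Y i 0 0 \<omega>)
        + pI 1 * (B \<omega> * Y i 1 1 \<omega>) - pI 1 * (B \<omega> * Y i 1 0 \<omega>))"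
      using BY[of 0 0] BY[of 0 1] BY[of 1 0] BY[of 1 1] by simp (simp add: algebra_simps)
    also have "\<dots> = v * expectation (\<lambda>\<omega>. B \<omega> * \<tau> \<omega>)"
      by (simp add: \<tau>_def avg_spillover_effect_def spillover_effect_def algebra_simps)
    finally show ?thesis .
  qed

  \<comment> \<open>The ratio and its reading as a conditional expectation\<close>
  have uncorr: "expectation (\<lambda>\<omega>. X \<omega> * (Z \<omega> - q)) = 0"
    using XZ[of "\<lambda>x. x" "\<lambda>z. z - q"] W0 by simp
  note tsls = two_stage_least_squares[OF Y S X Z q_def uncorr
      first_stage[folded X_def Z_def] second_stage[folded X_def Z_def]]
  \<comment> \<open>Relevance of the instrument gives both: \<open>v\<close> can be cancelled, and
    the conditioning event has positive probability.\<close>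
  have "expectation B \<noteq> 0" "v \<noteq> 0" using tsls(1) covS by auto
  with tsls(2) covS covY have \<beta>s: "\<beta>s = expectation (\<lambda>\<omega>. B \<omega> * \<tau> \<omega>) / expectation B"
    by (simp add: field_simps)
  let ?E = "{\<omega> \<in> space M. A (j i) \<omega> = 1}"
  have ind: "B \<omega> = indicator ?E \<omega>" if "\<omega> \<in> space M" for \<omega>
    using A_binary[OF \<open>i \<in> I\<close> that] that by (auto simp: B_def)
  have "expectation B = expectation (indicator ?E)"
    by (rule Bochner_Integration.integral_cong) (simp_all add: ind)
  then have EB: "expectation B = prob ?E" by simp
  have "expectation (\<lambda>\<omega>. B \<omega> * \<tau> \<omega>) = expectation (\<lambda>\<omega>. indicator ?E \<omega> * \<tau> \<omega>)"
    by (rule Bochner_Integration.integral_cong) (simp_all add: ind)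
  moreover have "cond_expectation_event M \<tau> ?E = expectation (\<lambda>\<omega>. indicator ?E \<omega> * \<tau> \<omega>) / prob ?E"
  proof (rule cond_expectation_event_eq)
    show "\<tau> \<in> borel_measurable M"
      unfolding \<tau>_def avg_spillover_effect_def[abs_def] spillover_effect_def by measurable
    show "emeasure M ?E \<noteq> 0"
      using EB \<open>expectation B \<noteq> 0\<close> by (auto simp: measure_def)
  qed auto
  ultimately show ?thesis by (simp add: \<beta>s EB \<tau>_def)
qed

end
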